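(* Let $k\ge2$ and $n_1,\dots,n_k\ge2$ be integers. Then $\Gamma(\mathbb{Z}_{n_1}\times\cdots\times\mathbb{Z}_{n_k})$ is chordal if and only if, up to reordering of the factors, the ring is $\mathbb{Z}_2\times\mathbb{Z}_p$ or $\mathbb{Z}_2\times\mathbb{Z}_{p^2}$ for some prime $p$, or $\mathbb{Z}_2\times\mathbb{Z}_2\times\mathbb{Z}_2$.
   Context: For a commutative ring $R$ with identity, the zero-divisor graph $\Gamma(R)$ is the simple undirected graph whose vertices are the nonzero zero-divisors of $R$, two distinct vertices $u,v$ being adjacent iff $uv=0$. A graph is chordal if every cycle of length greater than $3$ has a chord. *)

theory Defs
  imports
    "HOL-Algebra.Chinese_Remainder"
    "HOL-Number_Theory.Residues"
    "HOL-Library.Multiset"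
    "Graph_Theory.Pair_Digraph"
begin

definition zero_divisors :: "('a, 'b) ring_scheme \<Rightarrow> 'a set" where
  "zero_divisors R =
    {x \<in> carrier R. \<exists>y \<in> carrier R. y \<noteq> \<zero>\<^bsub>R\<^esub> \<and> x \<otimes>\<^bsub>R\<^esub> y = \<zero>\<^bsub>R\<^esub>}"

(* Simple undirected graphs are represented, as in Graph_Theory, by symmetric loop-free
   digraphs: an edge uv is the pair of arcs (u, v) and (v, u). *)
definition zero_divisor_graph :: "('a, 'b) ring_scheme \<Rightarrow> 'a pair_pre_digraph" where
  "zero_divisor_graph R =
    (let V = zero_divisors R - {\<zero>\<^bsub>R\<^esub>}
     in \<lparr> pverts = V,
          parcs = {(u, v). u \<in> V \<and> v \<in> V \<and> u \<noteq> v \<and> u \<otimes>\<^bsub>R\<^esub> v = \<zero>\<^bsub>R\<^esub>} \<rparr>)"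

lemma (in cring) pair_bidirected_digraph_zero_divisor_graph:
  "pair_bidirected_digraph (zero_divisor_graph R)"
proof unfold_locales
  show "symmetric (with_proj (zero_divisor_graph R))"
    unfolding symmetric_def sym_def
    by (auto simp: zero_divisor_graph_def Let_def zero_divisors_def m_comm)
qed (auto simp: zero_divisor_graph_def Let_def)

(* A cycle is given by its list p of arcs, so its vertices are the tails fst ` set p. A chord
   joins two of them without being an edge of the cycle, in either orientation. *)
definition is_chord :: "'a pair_pre_digraph \<Rightarrow> ('a \<times> 'a) awalk \<Rightarrow> 'a \<times> 'a \<Rightarrow> bool" where
  "is_chord G p e \<longleftrightarrow>
    e \<in> parcs G \<and> fst e \<in> fst ` set p \<and> snd e \<in> fst ` set p \<and>
    e \<notin> set p \<and> prod.swap e \<notin> set p"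

(* In a symmetric digraph pre_digraph.cycle also admits the degenerate arc lists
   [(u, v), (v, u)]; the bound on the length excludes them. *)
definition chordal :: "'a pair_pre_digraph \<Rightarrow> bool" where
  "chordal G \<longleftrightarrow>
    (\<forall>p. pre_digraph.cycle (with_proj G) p \<and> length p > 3 \<longrightarrow> (\<exists>e. is_chord G p e))"

end

theory Submission
  imports Defs
begin

text \<open>In each ring of the list the graph is a split graph: its vertices divide into a clique
  (\<open>(1, 0)\<close> together with the \<open>(0, b)\<close>, \<open>p\<close> dividing \<open>b\<close>, respectively the three unit vectors) and an
  independent set, and split graphs are chordal. In every other ring there are
  \<open>x \<noteq> x'\<close> and \<open>y \<noteq> y'\<close> with \<open>x x' \<noteq> 0\<close>, \<open>y y' \<noteq> 0\<close> and all mixed products zero, hence an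
  induced 4-cycle: with unit vectors \<open>e\<^sub>i\<close>, take \<open>y, y' = \<plusminus>e\<^sub>i\<close> if \<open>n\<^sub>i \<ge> 3\<close> and \<open>x, x'\<close> is
  \<open>e\<^sub>j, -e\<^sub>j\<close> (if \<open>n\<^sub>j \<ge> 3\<close>) or \<open>e\<^sub>j, e\<^sub>j + e\<^sub>l\<close>; for four factors take pairs of the latter kind; and for
  \<open>\<int>\<^sub>2 \<times> \<int>\<^sub>m\<close> with \<open>m = a b\<close>, \<open>a \<ge> 3\<close>, \<open>b \<ge> 2\<close> and \<open>a\<close> not dividing \<open>b\<close>, take \<open>(1, 0), (1, a)\<close> and \<open>(0, b), (0, -b)\<close>.\<close>

section \<open>Cycles, chords and split graphs\<close>

lemma (in pre_digraph) cas_awalk_verts: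
  assumes "cas u p v"
  shows "awalk_verts u p = u # map (head G) p" "awalk_verts u p = map (tail G) p @ [v]"
  using assms by (induction p arbitrary: u) auto

text \<open>The definition of \<open>cycle\<close> makes the heads of the arcs distinct. In a closed
  walk the tails are the same vertices, with the base point \<open>u\<close> moved to the front, so
  they are distinct as well.\<close>

lemma cycle_distinct:
  assumes "pre_digraph.cycle (with_proj G) p"
  shows "distinct (map fst p)" "distinct (map snd p)"
proof -
  obtain u where c: "pre_digraph.cas (with_proj G) u p u"
    and d: "distinct (tl (pre_digraph.awalk_verts (with_proj G) u p))"
    using assms by (auto simp: pre_digraph.cycle_def pre_digraph.awalk_def)
  note w = pre_digraph.cas_awalk_verts[OF c, simplified]
  show "distinct (map snd p)" using d w(1) by simp
  have "mset (u # map snd p) = mset (map fst p @ [u])" using w by simp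
  then have "mset (map snd p) = mset (map fst p)" by simp
  then show "distinct (map fst p)"
    using \<open>distinct (map snd p)\<close> mset_eq_imp_distinct_iff by blast
qed

text \<open>Each vertex of a cycle is the tail of only one of its arcs. The arc leaving
  \<open>u\<close> goes to \<open>v \<noteq> w\<close> and the one leaving \<open>w\<close> goes to
  \<open>x \<noteq> u\<close>, so the cycle uses the edge \<open>uw\<close> in neither
  direction.\<close>

lemma cycle_shortcut_is_chord:
  assumes cyc: "pre_digraph.cycle (with_proj G) p"
    and p: "(u, v) \<in> set p" "(v, w) \<in> set p" "(w, x) \<in> set p"
    and ne: "v \<noteq> w" "x \<noteq> u" and arc: "(u, w) \<in> parcs G"
  shows "is_chord G p (u, w)"
proof -
  have uniq: "b = c" if "(a, b) \<in> set p" "(a, c) \<in> set p" for a b c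
    using eq_key_imp_eq_value[OF cycle_distinct(1)[OF cyc] that] .
  have "(u, w) \<notin> set p" "(w, u) \<notin> set p"
    using uniq[OF p(1), of w] uniq[OF p(3), of u] ne by blast+
  moreover have "u \<in> fst ` set p" "w \<in> fst ` set p"
    using p(1,3)[THEN imageI, of fst] by simp_all
  ultimately show ?thesis
    using arc by (simp add: is_chord_def)
qed

text \<open>Among four consecutive vertices of a cycle in a split graph, two at distance two both lie
  in the clique \<open>K\<close>, unless the outer two lie outside \<open>K\<close>; then the next vertex is again in \<open>K\<close>.\<close>

lemma split_graph_chordal:
  assumes clique: "\<And>u v. \<lbrakk>u \<in> K; v \<in> K; u \<in> pverts G; v \<in> pverts G; u \<noteq> v\<rbrakk> \<Longrightarrow> (u, v) \<in> parcs G"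
    and indep: "\<And>u v. (u, v) \<in> parcs G \<Longrightarrow> u \<in> K \<or> v \<in> K"
    and wf: "parcs G \<subseteq> pverts G \<times> pverts G"
  shows "chordal G"
  unfolding chordal_def
proof (intro allI impI, elim conjE)
  fix p assume cyc: "pre_digraph.cycle (with_proj G) p" and len: "length p > 3"
  obtain u where c: "pre_digraph.cas (with_proj G) u p u" and arcs: "set p \<subseteq> parcs G"
    using cyc by (auto simp: pre_digraph.cycle_def pre_digraph.awalk_def)
  obtain e0 e1 e2 e3 q where p0: "p = e0 # e1 # e2 # e3 # q"
    using len by (auto simp: less_eq_Suc_le numeral_eq_Suc Suc_le_length_iff)
  obtain v1 v2 v3 v4 where p: "p = (u, v1) # (v1, v2) # (v2, v3) # (v3, v4) # q"
    using c p0 by (cases e0; cases e1; cases e2; cases e3) (auto simp: pre_digraph.cas.simps)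
  have c4: "pre_digraph.cas (with_proj G) v4 q u"
    using c p by (auto simp: pre_digraph.cas.simps)
  have d: "u \<noteq> v2" "v1 \<noteq> v2" "v3 \<noteq> u" "v1 \<noteq> v3" "v2 \<noteq> v3" "v4 \<noteq> v1" "v2 \<noteq> v4" "v3 \<noteq> v4"
    using cycle_distinct[OF cyc] by (auto simp: p)
  have V: "u \<in> pverts G" "v1 \<in> pverts G" "v2 \<in> pverts G" "v3 \<in> pverts G" "v4 \<in> pverts G"
    and A: "(u, v1) \<in> parcs G" "(v1, v2) \<in> parcs G" "(v2, v3) \<in> parcs G" "(v3, v4) \<in> parcs G"
    using arcs wf by (auto simp: p)
  have I: "u \<in> K \<or> v1 \<in> K" "v1 \<in> K \<or> v2 \<in> K" "v2 \<in> K \<or> v3 \<in> K" "v3 \<in> K \<or> v4 \<in> K"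
    using A[THEN indep] .
  consider "u \<in> K" "v2 \<in> K" | "v1 \<in> K" "v3 \<in> K" | "u \<notin> K" "v3 \<notin> K" "v2 \<in> K" "v4 \<in> K"
    using I by blast
  then show "\<exists>e. is_chord G p e"
  proof cases
    case 1
    have "is_chord G p (u, v2)"
      using cycle_shortcut_is_chord[OF cyc, of u v1 v2 v3] clique[OF 1 V(1,3) d(1)] d(2,3)
      by (simp add: p)
    then show ?thesis ..
  next
    case 2
    have "is_chord G p (v1, v3)"
      using cycle_shortcut_is_chord[OF cyc, of v1 v2 v3 v4] clique[OF 2 V(2,4) d(4)] d(5,6)
      by (simp add: p)
    then show ?thesis ..
  next
    case 3
    \<comment> \<open>\<open>v4\<close> lies in \<open>K\<close> and \<open>u\<close> does not, so
      the cycle has not closed yet; this provides the fifth arc \<open>(v4, x)\<close> that the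
      shortcut from \<open>v2\<close> to \<open>v4\<close> requires.\<close>
    then have "v4 \<noteq> u" by blast
    then obtain x r where q: "q = (v4, x) # r"
      using c4 by (cases q) (auto simp: pre_digraph.cas.simps)
    then have "x \<noteq> v2"
      using cycle_distinct(2)[OF cyc] by (auto simp: p)
    then have "is_chord G p (v2, v4)"
      using cycle_shortcut_is_chord[OF cyc, of v2 v3 v4 x] clique[OF 3(3,4) V(3,5) d(7)] d(8)
      by (simp add: p q)
    then show ?thesis ..
  qed
qed

text \<open>With only four vertices and no loops, a chord would have to run along a diagonal;
  symmetry reduces both orientations to the two excluded arcs.\<close>

lemma induced_C4_not_chordal:
  assumes arcs: "(a, b) \<in> parcs G" "(b, c) \<in> parcs G" "(c, d) \<in> parcs G" "(d, a) \<in> parcs G"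
    and sym: "sym (parcs G)" and irrefl: "irrefl (parcs G)" and "a \<in> pverts G"
    and diag: "(a, c) \<notin> parcs G" "(b, d) \<notin> parcs G" and ne: "a \<noteq> c" "b \<noteq> d"
  shows "\<not> chordal G"
proof
  define p where "p = [(a, b), (b, c), (c, d), (d, a)]"
  have no_loop: "(x, x) \<notin> parcs G" for x using irrefl by (auto simp: irrefl_def)
  have "pre_digraph.cycle (with_proj G) p"
    unfolding pre_digraph.cycle_def
    by (rule exI[of _ a]) (use assms no_loop in
        \<open>auto simp: p_def pre_digraph.awalk_def pre_digraph.cas.simps pre_digraph.awalk_verts.simps\<close>)
  moreover assume "chordal G"
  ultimately obtain e where "is_chord G p e"
    unfolding chordal_def by (force simp: p_def)
  then show False
    using no_loop diag symD[OF sym] by (cases e) (auto simp: is_chord_def p_def)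
qed

section \<open>Zero-divisor graphs of products of residue rings, coordinate by coordinate\<close>

lemma parcs_zero_divisor_graph_subset:
  "parcs (zero_divisor_graph R) \<subseteq> pverts (zero_divisor_graph R) \<times> pverts (zero_divisor_graph R)"
  by (auto simp: zero_divisor_graph_def Let_def)

lemma mult_RDirProd_list:
  assumes "u \<in> carrier (RDirProd_list Rs)" "v \<in> carrier (RDirProd_list Rs)"
  shows "u \<otimes>\<^bsub>RDirProd_list Rs\<^esub> v = map (\<lambda>i. u ! i \<otimes>\<^bsub>Rs ! i\<^esub> v ! i) [0..<length Rs]"
  using assms
proof (induction Rs arbitrary: u v)
  case Nil
  then show ?case by (simp add: monoid.defs)
next
  case (Cons R Rs)
  obtain a as b bs where u: "u = a # as" "a \<in> carrier R" "as \<in> carrier (RDirProd_list Rs)"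
    and v: "v = b # bs" "b \<in> carrier R" "bs \<in> carrier (RDirProd_list Rs)"
    using Cons.prems by (auto simp: RDirProd_list_carrier)
  have "u \<otimes>\<^bsub>RDirProd_list (R # Rs)\<^esub> v = (a \<otimes>\<^bsub>R\<^esub> b) # (as \<otimes>\<^bsub>RDirProd_list Rs\<^esub> bs)"
    \<comment> \<open>Consing is a ring homomorphism from the binary product, so multiplication
      splits off the head factor.\<close>
    using ring_hom_mult[OF RDirProd_list_hom1[of R Rs], of "(a, as)" "(b, bs)"] u v
    by (simp add: RDirProd_carrier) (simp add: RDirProd_def DirProd_def monoid.defs)
  then show ?case
    using Cons.IH u v by (simp add: map_upt_Suc del: upt_Suc)
qed

lemma zero_RDirProd_list: "\<zero>\<^bsub>RDirProd_list Rs\<^esub> = map (\<lambda>R. \<zero>\<^bsub>R\<^esub>) Rs"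
  unfolding RDirProd_list_zero by (induction Rs) auto

abbreviation residue_product :: "int list \<Rightarrow> int list ring" where
  "residue_product ns \<equiv> RDirProd_list (map residue_ring ns)"

lemma carrier_residue_product:
  "u \<in> carrier (residue_product ns) \<longleftrightarrow>
    length u = length ns \<and> (\<forall>i<length ns. 0 \<le> u ! i \<and> u ! i < ns ! i)"
proof -
  have "u \<in> carrier (residue_product ns) \<longleftrightarrow>
      length u = length ns \<and> (\<forall>i<length ns. u ! i \<in> carrier (residue_ring (ns ! i)))"
    using RDirProd_list_carrier_mem[of u "map residue_ring ns"]
      RDirProd_list_carrier_memI[of u "map residue_ring ns"] by fastforce
  then show ?thesis by (auto simp: residue_ring_def)
qed

lemma eq_zero_residue_product_iff:
  assumes "length u = length ns"
  shows "u = \<zero>\<^bsub>residue_product ns\<^esub> \<longleftrightarrow> (\<forall>i<length ns. u ! i = 0)"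
  using assms by (auto simp: zero_RDirProd_list list_eq_iff_nth_eq residue_ring_def)

lemma mult_eq_zero_residue_product_iff:
  assumes "u \<in> carrier (residue_product ns)" "v \<in> carrier (residue_product ns)"
  shows "u \<otimes>\<^bsub>residue_product ns\<^esub> v = \<zero>\<^bsub>residue_product ns\<^esub> \<longleftrightarrow>
    (\<forall>i<length ns. ns ! i dvd u ! i * v ! i)"
  by (auto simp: mult_RDirProd_list[OF assms] eq_zero_residue_product_iff residue_ring_def
      mod_eq_0_iff_dvd)

lemma pverts_residue_productD:
  assumes "u \<in> pverts (zero_divisor_graph (residue_product ns))"
  shows "length u = length ns" "i < length ns \<Longrightarrow> 0 \<le> u ! i \<and> u ! i < ns ! i"
    and "\<exists>i<length ns. u ! i \<noteq> 0"
  using assms eq_zero_residue_product_iff[of u ns]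
  by (auto simp: zero_divisor_graph_def Let_def zero_divisors_def carrier_residue_product)

lemma parcs_residue_product_iff:
  "(u, v) \<in> parcs (zero_divisor_graph (residue_product ns)) \<longleftrightarrow>
    u \<in> pverts (zero_divisor_graph (residue_product ns)) \<and>
    v \<in> pverts (zero_divisor_graph (residue_product ns)) \<and>
    u \<noteq> v \<and> (\<forall>i<length ns. ns ! i dvd u ! i * v ! i)"
  using mult_eq_zero_residue_product_iff[of u ns v]
  by (auto simp: zero_divisor_graph_def Let_def zero_divisors_def)

lemma pverts_residue_productI:
  assumes "u \<in> carrier (residue_product ns)" "v \<in> carrier (residue_product ns)"
    and "\<exists>i<length ns. u ! i \<noteq> 0" "\<exists>i<length ns. v ! i \<noteq> 0"
    and "\<forall>i<length ns. ns ! i dvd u ! i * v ! i"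
  shows "u \<in> pverts (zero_divisor_graph (residue_product ns))"
  using assms mult_eq_zero_residue_product_iff[of u ns v] eq_zero_residue_product_iff[of u ns]
    eq_zero_residue_product_iff[of v ns]
  by (auto simp: zero_divisor_graph_def Let_def zero_divisors_def carrier_residue_product)

text \<open>The vectors \<open>x, y, x', y'\<close> give an induced 4-cycle, in this order.\<close>

lemma residue_product_not_chordal:
  fixes x x' y y' :: "nat \<Rightarrow> int"
  assumes pos: "\<And>i. i < length ns \<Longrightarrow> ns ! i > 0"
    and zero: "\<And>i. i < length ns \<Longrightarrow> ns ! i dvd x i * y i" "\<And>i. i < length ns \<Longrightarrow> ns ! i dvd x i * y' i"
      "\<And>i. i < length ns \<Longrightarrow> ns ! i dvd x' i * y i" "\<And>i. i < length ns \<Longrightarrow> ns ! i dvd x' i * y' i"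
    and ne: "\<exists>i<length ns. \<not> ns ! i dvd x i - x' i" "\<exists>i<length ns. \<not> ns ! i dvd y i - y' i"
    and nz: "\<exists>i<length ns. \<not> ns ! i dvd x i * x' i" "\<exists>i<length ns. \<not> ns ! i dvd y i * y' i"
  shows "\<not> chordal (zero_divisor_graph (residue_product ns))"
proof -
  let ?G = "zero_divisor_graph (residue_product ns)"
  \<comment> \<open>Reducing each coordinate lets the witnesses be arbitrary integer vectors,
    negative entries included; all conditions on them become divisibilities.\<close>
  define r where "r c = map (\<lambda>i. c i mod ns ! i) [0..<length ns]" for c :: "nat \<Rightarrow> int"
  have r_nth: "r c ! i = c i mod ns ! i" if "i < length ns" for c i
    using that by (simp add: r_def)
  have r_carrier: "r c \<in> carrier (residue_product ns)" for c
    using pos by (auto simp: carrier_residue_product r_nth) (simp add: r_def)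
  have r_mult: "ns ! i dvd r c ! i * r d ! i \<longleftrightarrow> ns ! i dvd c i * d i" if "i < length ns" for c d i
    unfolding dvd_eq_mod_eq_0 by (simp only: r_nth[OF that] mod_mult_eq)
  have r_eq: "r c = r d \<longleftrightarrow> (\<forall>i<length ns. ns ! i dvd c i - d i)" for c d
    by (simp only: r_def map_eq_conv set_upt atLeast0LessThan Ball_def lessThan_iff mod_eq_dvd_iff)
  have r_nz: "(\<exists>i<length ns. r c ! i \<noteq> 0) \<and> (\<exists>i<length ns. r d ! i \<noteq> 0)"
    if *: "\<exists>i<length ns. \<not> ns ! i dvd c i * d i" for c d
  proof -
    obtain i where i: "i < length ns" "\<not> ns ! i dvd c i * d i" using * by blast
    then have "r c ! i \<noteq> 0" "r d ! i \<noteq> 0" by (auto simp: r_nth mod_eq_0_iff_dvd)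
    then show ?thesis using i by blast
  qed
  note nonzero = r_nz[OF nz(1)] r_nz[OF nz(2)]
  have V: "r x \<in> pverts ?G" "r x' \<in> pverts ?G" "r y \<in> pverts ?G" "r y' \<in> pverts ?G"
    using pverts_residue_productI[OF r_carrier r_carrier, of x y]
      pverts_residue_productI[OF r_carrier r_carrier, of x' y]
      pverts_residue_productI[OF r_carrier r_carrier, of y x]
      pverts_residue_productI[OF r_carrier r_carrier, of y' x]
      nonzero zero by (auto simp: r_mult mult.commute)
  \<comment> \<open>Two vectors differ if some \<open>e\<close> annihilates one and not the other.
    This gives the distinctness of neighbours on the 4-cycle.\<close>
  have sep: "r c \<noteq> r d"
    if "\<And>i. i < length ns \<Longrightarrow> ns ! i dvd c i * e i" "\<exists>i<length ns. \<not> ns ! i dvd d i * e i" for c d e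
    using that by (metis r_mult)
  have cross: "r x \<noteq> r y" "r y \<noteq> r x'" "r x' \<noteq> r y'" "r y' \<noteq> r x"
  proof -
    show "r x \<noteq> r y" by (rule sep[of x y' y]) (use zero nz in auto)
    show "r y \<noteq> r x'" by (rule sep[of y x x']) (use zero nz in \<open>auto simp: mult.commute\<close>)
    show "r x' \<noteq> r y'" by (rule sep[of x' y y']) (use zero nz in \<open>auto simp: mult.commute\<close>)
    show "r y' \<noteq> r x" by (rule sep[of y' x' x]) (use zero nz in \<open>auto simp: mult.commute\<close>)
  qed
  have E: "(r x, r y) \<in> parcs ?G" "(r y, r x') \<in> parcs ?G" "(r x', r y') \<in> parcs ?G"
    "(r y', r x) \<in> parcs ?G"
    using V cross zero by (auto simp: parcs_residue_product_iff r_mult mult.commute)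
  have "sym (parcs ?G)" "irrefl (parcs ?G)"
    by (auto simp: sym_def irrefl_def parcs_residue_product_iff mult.commute)
  moreover have "(r x, r x') \<notin> parcs ?G" "(r y, r y') \<notin> parcs ?G"
    using nz by (auto simp: parcs_residue_product_iff r_mult)
  moreover have "r x \<noteq> r x'" "r y \<noteq> r y'" using ne by (auto simp: r_eq)
  ultimately show ?thesis
    using induced_C4_not_chordal[OF E] V(1) by blast
qed

section \<open>Chordality of the listed rings\<close>

text \<open>The indices \<open>i\<close> and \<open>j\<close> allow the factor 2 in either position,
  so that reordering needs no ring isomorphism.\<close>

lemma chordal_two_prime_power:
  fixes p m :: int
  assumes "prime p" and m: "m = p \<or> m = p\<^sup>2"
    and ns: "length ns = 2" "{i, j} = {0, 1}" "ns ! i = 2" "ns ! j = m"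
  shows "chordal (zero_divisor_graph (residue_product ns))"
proof -
  let ?G = "zero_divisor_graph (residue_product ns)"
  \<comment> \<open>For \<open>m = p\<close> the second kind contributes no vertex, since
    \<open>p dvd u ! j\<close> and \<open>u ! j < p\<close> force the zero vector; the graph is then
    a star around the vertex of the first kind.\<close>
  define K where "K = {u :: int list. u ! i = 1 \<and> u ! j = 0 \<or> u ! i = 0 \<and> p dvd u ! j}"
  have all: "(\<forall>k<length ns. P k) \<longleftrightarrow> P i \<and> P j" for P
    using ns(1,2) by (auto simp: doubleton_eq_iff less_2_cases_iff)
  have ex: "(\<exists>k<length ns. P k) \<longleftrightarrow> P i \<or> P j" for P
    using all[of "\<lambda>k. \<not> P k"] by blast
  have lt: "i < length ns" "j < length ns" using ns(1,2) by (auto simp: doubleton_eq_iff)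
  have V: "length u = length ns \<and> (u ! i = 0 \<or> u ! i = 1) \<and> 0 \<le> u ! j \<and> u ! j < m
      \<and> (u ! i \<noteq> 0 \<or> u ! j \<noteq> 0)" if "u \<in> pverts ?G" for u
    using pverts_residue_productD[OF that] lt ns by (force simp: ex)
  have eq: "u = v \<longleftrightarrow> u ! i = v ! i \<and> u ! j = v ! j" if "u \<in> pverts ?G" "v \<in> pverts ?G" for u v
    using V[OF that(1)] V[OF that(2)] all[of "\<lambda>k. u ! k = v ! k"] by (auto simp: list_eq_iff_nth_eq)
  have p2: "p * p dvd a * b" if "p dvd a" "p dvd b" for a b
    using that by (rule mult_dvd_mono)
  have coprime_case: "b = 0" if "m dvd a * b" "\<not> p dvd a" "0 \<le> b" "b < m" for a b
  proof -
    have "coprime p a" using that \<open>prime p\<close> by (simp add: prime_imp_coprime)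
    then have "coprime m a" using m by auto
    then have "m dvd b" using that by (simp add: coprime_dvd_mult_right_iff)
    then show "b = 0" using that zdvd_not_zless by force
  qed
  show ?thesis
  proof (rule split_graph_chordal[of K])
    fix u v assume "u \<in> K" "v \<in> K" "u \<in> pverts ?G" "v \<in> pverts ?G" "u \<noteq> v"
    then show "(u, v) \<in> parcs ?G"
      using eq[of u v] m p2[of "u ! j" "v ! j"]
      unfolding parcs_residue_product_iff all by (auto simp: ns(3,4) K_def power2_eq_square)
  next
    fix u v assume e: "(u, v) \<in> parcs ?G"
    then have uv: "u \<in> pverts ?G" "v \<in> pverts ?G" and d: "2 dvd u ! i * v ! i" "m dvd u ! j * v ! j"
      unfolding parcs_residue_product_iff all by (auto simp: ns(3,4))
    note Vu = V[OF uv(1)] and Vv = V[OF uv(2)]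
    \<comment> \<open>Take the endpoint with entry 0 at \<open>i\<close>. If it is outside
      \<open>K\<close>, its entry at \<open>j\<close> is a unit modulo \<open>m\<close>, so the
      other endpoint vanishes at \<open>j\<close> and, being nonzero, has entry 1 at
      \<open>i\<close>.\<close>
    have "u ! i = 0 \<or> v ! i = 0" using d(1) Vu Vv by auto
    then show "u \<in> K \<or> v \<in> K"
    proof
      assume "u ! i = 0"
      show ?thesis
      proof (cases "p dvd u ! j")
        case False
        then have "v ! j = 0" using coprime_case[of "u ! j" "v ! j"] d(2) Vv by simp
        then show ?thesis using Vv by (auto simp: K_def)
      qed (simp add: K_def \<open>u ! i = 0\<close>)
    next
      assume "v ! i = 0"
      show ?thesis
      proof (cases "p dvd v ! j")
        case False
        then have "u ! j = 0"
          using coprime_case[of "v ! j" "u ! j"] d(2) Vu by (simp add: mult.commute)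
        then show ?thesis using Vu by (auto simp: K_def)
      qed (simp add: K_def \<open>v ! i = 0\<close>)
    qed
  qed (rule parcs_zero_divisor_graph_subset)
qed

text \<open>Adjacency means disjoint supports, and two subsets of a 3-element set with at least two
  elements each always meet; hence the vertices other than unit vectors are independent.\<close>

lemma chordal_two_two_two: "chordal (zero_divisor_graph (residue_product [2, 2, 2]))"
proof -
  let ?G = "zero_divisor_graph (residue_product [2, 2, 2])"
  define K :: "int list set" where "K = {[1, 0, 0], [0, 1, 0], [0, 0, 1]}"
  have all: "(\<forall>k<length [2, 2, 2 :: int]. P k) \<longleftrightarrow> P 0 \<and> P 1 \<and> P 2" for P
    by (auto simp: less_Suc_eq numeral_eq_Suc)
  have V: "u \<in> K \<union> {[1, 1, 0], [1, 0, 1], [0, 1, 1], [1, 1, 1]}" if "u \<in> pverts ?G" for u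
  proof -
    note u = pverts_residue_productD[OF that]
    obtain a b c where abc: "u = [a, b, c]"
      using u(1) by (auto simp: length_Suc_conv)
    have "a \<in> {0, 1}" "b \<in> {0, 1}" "c \<in> {0, 1}" "\<not> (a = 0 \<and> b = 0 \<and> c = 0)"
      using u(2)[of 0] u(2)[of 1] u(2)[of 2] u(3) all[of "\<lambda>i. u ! i = 0"] by (auto simp: abc)
    then show ?thesis by (auto simp: abc K_def)
  qed
  show ?thesis
  proof (rule split_graph_chordal[of K])
    fix u v assume "u \<in> K" "v \<in> K" "u \<in> pverts ?G" "v \<in> pverts ?G" "u \<noteq> v"
    then show "(u, v) \<in> parcs ?G"
      unfolding parcs_residue_product_iff all by (auto simp: K_def)
  next
    fix u v assume e: "(u, v) \<in> parcs ?G"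
    then show "u \<in> K \<or> v \<in> K"
      using V[of u] V[of v] unfolding parcs_residue_product_iff all by auto
  qed (rule parcs_zero_divisor_graph_subset)
qed

section \<open>Excluding all other rings, and the equivalence\<close>

text \<open>Write \<open>m = c * p\<close> with \<open>p\<close> prime; the hypotheses exclude
  \<open>c = 1\<close> and \<open>c = p\<close>. If \<open>c = 2\<close>, then \<open>p\<close> is
  odd and \<open>a = p\<close>, \<open>b = 2\<close> works; otherwise \<open>c \<ge> 3\<close> does
  not divide the prime \<open>p\<close>, and \<open>a = c\<close>, \<open>b = p\<close>
  works.\<close>

lemma not_prime_power_le_2_factorization:
  fixes m :: int
  assumes "m \<ge> 2" "\<not> prime m" "\<And>p. prime p \<Longrightarrow> m \<noteq> p\<^sup>2"
  obtains a b where "m = a * b" "a \<ge> 3" "b \<ge> 2" "\<not> a dvd b"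
proof -
  obtain p where p: "prime p" "p dvd m"
    using prime_divisor_exists[of m] assms(1) by auto
  then obtain c where c: "m = c * p" by (auto simp: mult.commute elim: dvdE)
  have "p \<ge> 2" using p(1) prime_ge_2_int by blast
  then have "c > 0" using assms(1) c by (smt (verit) mult_nonpos_nonneg)
  have "c \<noteq> 1" "c \<noteq> p" using assms p(1) c by (auto simp: power2_eq_square)
  show ?thesis
  proof (cases "c = 2")
    case True
    then have "\<not> p dvd 2" using \<open>c \<noteq> p\<close> \<open>p \<ge> 2\<close> by (auto dest: zdvd_imp_le)
    with True c that[of p 2] \<open>c \<noteq> p\<close> \<open>p \<ge> 2\<close> show ?thesis by auto
  next
    case False
    have "\<not> c dvd p"
      using p(1) \<open>c > 0\<close> \<open>c \<noteq> 1\<close> \<open>c \<noteq> p\<close> unfolding prime_int_iff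
      by (metis less_imp_le)
    with False c that[of c p] \<open>c > 0\<close> \<open>c \<noteq> 1\<close> \<open>p \<ge> 2\<close> show ?thesis by auto
  qed
qed

theorem theorem3p16:
  fixes ns :: "int list"
  assumes "length ns \<ge> 2"
    and "\<forall>n \<in> set ns. n \<ge> 2"
  shows "chordal (zero_divisor_graph (RDirProd_list (map residue_ring ns))) \<longleftrightarrow>
    (\<exists>p. prime p \<and> (mset ns = {#2, p#} \<or> mset ns = {#2, p\<^sup>2#})) \<or>
    mset ns = {#2, 2, 2#}"
proof
  assume chordal: "chordal (zero_divisor_graph (residue_product ns))"
  have ge2: "ns ! i \<ge> 2" if "i < length ns" for i using assms(2) that by simp
  then have pos: "ns ! i > 0" if "i < length ns" for i using that by force
  have not_dvd: "\<not> ns ! i dvd 1" "\<not> ns ! i dvd - 1" if "i < length ns" for i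
    using ge2[OF that] by auto
  \<comment> \<open>The 4-cycle criterion as a contradiction to chordality; its vectors are
    instantiated below in the order \<open>x\<close>, \<open>y\<close>, \<open>y'\<close>,
    \<open>x'\<close>.\<close>
  note C4 = residue_product_not_chordal[OF pos, THEN notE, OF _ _ _ _ _ _ _ _ _ chordal]
  have no_large: False if "i < length ns" "ns ! i \<ge> 3" "x i = 0" "x' i = 0"
    "\<exists>k<length ns. \<not> ns ! k dvd x k - x' k" "\<exists>k<length ns. \<not> ns ! k dvd x k * x' k"
  for i and x x' :: "nat \<Rightarrow> int"
  proof (rule C4[of x "\<lambda>k. of_bool (k = i)" "\<lambda>k. - of_bool (k = i)" x'])
    \<comment> \<open>This separates \<open>e_i\<close> from \<open>-e_i\<close>.\<close>
    have "\<not> ns ! i dvd 2" using that by (auto dest: zdvd_imp_le)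
    then show "\<exists>k<length ns. \<not> ns ! k dvd of_bool (k = i) - - of_bool (k = i)"
      using that(1) by (intro exI[of _ i]) simp
    show "\<exists>k<length ns. \<not> ns ! k dvd of_bool (k = i) * - of_bool (k = i)"
      using that(1) not_dvd by (intro exI[of _ i]) simp
  qed (use that in auto)
  have large_pair: False if "i < length ns" "j < length ns" "i \<noteq> j" "ns ! i \<ge> 3" "ns ! j \<ge> 3" for i j
  proof (rule no_large[of i "\<lambda>k. of_bool (k = j)" "\<lambda>k. - of_bool (k = j)"])
    have "\<not> ns ! j dvd 2" using that by (auto dest: zdvd_imp_le)
    then show "\<exists>k<length ns. \<not> ns ! k dvd of_bool (k = j) - - of_bool (k = j)"
      using that(2) by (intro exI[of _ j]) simp
    show "\<exists>k<length ns. \<not> ns ! k dvd of_bool (k = j) * - of_bool (k = j)"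
      using that(2) not_dvd by (intro exI[of _ j]) simp
  qed (use that in auto)
  \<comment> \<open>Since \<open>e_j = -e_j\<close> when \<open>ns ! j = 2\<close>, a third index
    \<open>l\<close> is used to separate \<open>x\<close> from \<open>x'\<close>, while index
    \<open>j\<close> keeps their product nonzero.\<close>
  have large_three: False
    if "i < length ns" "j < length ns" "l < length ns" "ns ! i \<ge> 3" "i \<noteq> j" "i \<noteq> l" "j \<noteq> l" for i j l
  proof (rule no_large[of i "\<lambda>k. of_bool (k = j)" "\<lambda>k. of_bool (k = j \<or> k = l)"])
    show "\<exists>k<length ns. \<not> ns ! k dvd of_bool (k = j) - of_bool (k = j \<or> k = l)"
      using that not_dvd by (intro exI[of _ l]) simp
    show "\<exists>k<length ns. \<not> ns ! k dvd of_bool (k = j) * of_bool (k = j \<or> k = l)"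
      using that not_dvd by (intro exI[of _ j]) simp
  qed (use that in auto)
  \<comment> \<open>The supports lie in the disjoint blocks \<open>{0, 1}\<close> and
    \<open>{2, 3}\<close>, so mixed products vanish; indices 1 and 3 separate the two vectors of
    each pair.\<close>
  have le3: False if "length ns \<ge> 4"
  proof (rule C4[of "\<lambda>k. of_bool (k = 0)" "\<lambda>k. of_bool (k = 2)"
        "\<lambda>k. of_bool (k = 2 \<or> k = 3)" "\<lambda>k. of_bool (k = 0 \<or> k = 1)"])
    show "\<exists>k<length ns. \<not> ns ! k dvd of_bool (k = 0) - of_bool (k = 0 \<or> k = 1)"
      using that not_dvd by (intro exI[of _ 1]) simp
    show "\<exists>k<length ns. \<not> ns ! k dvd of_bool (k = 2) - of_bool (k = 2 \<or> k = 3)"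
      using that not_dvd by (intro exI[of _ 3]) simp
    show "\<exists>k<length ns. \<not> ns ! k dvd of_bool (k = 0) * of_bool (k = 0 \<or> k = 1)"
      using that not_dvd[of 0] by (intro exI[of _ 0]) (cases ns; simp)
    show "\<exists>k<length ns. \<not> ns ! k dvd of_bool (k = 2) * of_bool (k = 2 \<or> k = 3)"
      using that not_dvd by (intro exI[of _ 2]) simp
  qed auto
  have prime_power: "\<exists>p. prime p \<and> (ns ! i = p \<or> ns ! i = p\<^sup>2)"
    if ij: "i < length ns" "j < length ns" "i \<noteq> j" for i j
  proof (rule ccontr)
    assume neg: "\<not> ?thesis"
    obtain a b where ab: "ns ! i = a * b" "a \<ge> 3" "b \<ge> 2" "\<not> a dvd b"
      by (rule not_prime_power_le_2_factorization[of "ns ! i"]) (use neg ge2 ij in auto)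
    have "\<not> a dvd 2" using ab(2) by (auto dest: zdvd_imp_le)
    \<comment> \<open>In order: the product of \<open>b e_i\<close> and \<open>-b e_i\<close> is
      nonzero because \<open>a\<close> does not divide \<open>b\<close>; these two vectors differ
      because \<open>a \<ge> 3\<close>; and \<open>e_j\<close> differs from
      \<open>e_j + a e_i\<close> because \<open>b \<ge> 2\<close>.\<close>
    have ndvd: "\<not> a * b dvd b * b" "\<not> a * b dvd 2 * b" "\<not> a * b dvd a * 1"
      using ab \<open>\<not> a dvd 2\<close> by auto
    show False
    proof (rule C4[of "\<lambda>k. of_bool (k = j)" "\<lambda>k. b * of_bool (k = i)"
          "\<lambda>k. - b * of_bool (k = i)" "\<lambda>k. of_bool (k = j) + a * of_bool (k = i)"])
      show "\<exists>k<length ns. \<not> ns ! k dvd of_bool (k = j) - (of_bool (k = j) + a * of_bool (k = i))"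
        using ij ab ndvd by (intro exI[of _ i]) simp
      show "\<exists>k<length ns. \<not> ns ! k dvd b * of_bool (k = i) - - b * of_bool (k = i)"
        using ij ab ndvd by (intro exI[of _ i]) simp
      show "\<exists>k<length ns. \<not> ns ! k dvd of_bool (k = j) * (of_bool (k = j) + a * of_bool (k = i))"
        using ij not_dvd by (intro exI[of _ j]) simp
      show "\<exists>k<length ns. \<not> ns ! k dvd b * of_bool (k = i) * (- b * of_bool (k = i))"
        using ij ab ndvd by (intro exI[of _ i]) simp
    qed (use ij ab in auto)
  qed
  have "length ns < 4" using le3 not_less by blast
  then consider "length ns = 2" | "length ns = 3" using assms(1) by linarith
  then show "(\<exists>p. prime p \<and> (mset ns = {#2, p#} \<or> mset ns = {#2, p\<^sup>2#})) \<or> mset ns = {#2, 2, 2#}"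
  proof cases
    case 1
    then obtain a b where ns: "ns = [a, b]" by (auto simp: length_Suc_conv numeral_2_eq_2)
    have "a = 2 \<or> b = 2" using large_pair[of 0 1] assms(2) by (force simp: ns)
    then show ?thesis
      using prime_power[of 0 1] prime_power[of 1 0] by (auto simp: ns add_mset_commute)
  next
    case 2
    then obtain a b c where ns: "ns = [a, b, c]" by (auto simp: length_Suc_conv numeral_3_eq_3)
    \<comment> \<open>Each instance puts another factor in the role of the one that is at least
      3.\<close>
    have "a = 2" "b = 2" "c = 2"
      using large_three[of 0 1 2] large_three[of 1 0 2] large_three[of 2 0 1] assms(2)
      by (force simp: ns)+
    then show ?thesis by (simp add: ns)
  qed
next
  assume R: "(\<exists>p. prime p \<and> (mset ns = {#2, p#} \<or> mset ns = {#2, p\<^sup>2#})) \<or> mset ns = {#2, 2, 2#}"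
  have two: "chordal (zero_divisor_graph (residue_product ns))"
    if ms: "mset ns = {#2, m#}" and p: "prime p" "m = p \<or> m = p\<^sup>2" for p m
  proof -
    have len: "length ns = 2" using arg_cong[OF ms, of size] by simp
    then obtain a b where ab: "ns = [a, b]" by (auto simp: length_Suc_conv numeral_2_eq_2)
    have "a = 2 \<and> b = m \<or> a = m \<and> b = 2"
      using ms add_eq_conv_ex[of a "{#b#}" 2 "{#m#}"] by (auto simp: ab)
    \<comment> \<open>The multiset leaves the order open, so both assignments of \<open>i\<close>
      and \<open>j\<close> occur.\<close>
    then show ?thesis
      using chordal_two_prime_power[OF p len, of 0 1] chordal_two_prime_power[OF p len, of 1 0]
      by (auto simp: ab)
  qed
  have "ns = [2, 2, 2]" if "mset ns = {#2, 2, 2#}"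
  proof -
    have "length ns = 3" "set ns = {2}"
      using arg_cong[OF that, of size] arg_cong[OF that, of set_mset] by simp_all
    then have "replicate 3 2 = ns" using replicate_length_same[of ns 2] by simp
    then show ?thesis by (simp add: numeral_3_eq_3)
  qed
  then show "chordal (zero_divisor_graph (residue_product ns))"
    using R two chordal_two_two_two by blast
qed

end
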